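(* Let $G$ be a finite, simple, undirected graph with $n \ge 2$ vertices, not necessarily connected, and let $\Delta(G)$ denote its maximum degree. Then $b(G) = 2$ if and only if $\Delta(G) \geq n-2$.
   Context: Graph burning: initially all vertices of a finite simple undirected graph $G$ are unburned. The process runs in rounds $t = 1, 2, 3, \dots$. In round $t$, a vertex $x_t$ that is not burned at the end of round $t-1$ is chosen as a new source of fire and becomes burned; simultaneously, every vertex adjacent to a vertex that was burned at the end of round $t-1$ becomes burned. Burned vertices remain burned. The process ends at the first round after which all vertices of $G$ are burned. The sequence $(x_1, x_2, \dots, x_k)$ of chosen sources is called a burning sequence. The burning number $b(G)$ is the minimum, over all choices of sources, of the number of rounds needed to burn all vertices of $G$ (the minimum length of a burning sequence). *)

theory Defs
  imports "Graph_Theory.Digraph"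
begin

text \<open>
  Finite simple undirected graphs are the locale \<^locale>\<open>graph\<close>: finite, loop-free, symmetric
  digraphs without parallel arcs.  An edge is a pair of opposite arcs, so the degree of a vertex
  is its out-degree.
\<close>

definition max_degree :: "('a, 'b) pre_digraph \<Rightarrow> nat" where
  "max_degree G = Max (out_degree G ` verts G)"

text \<open>
  \<open>burned G xs t\<close> is the set of vertices burned at the end of round \<open>t\<close>.  Rounds are numbered
  from 1, lists from 0: the source \<open>x\<^sub>t\<close> chosen in round \<open>t\<close> is \<open>xs ! (t - 1)\<close>.  The value is
  meaningful only for \<open>t \<le> length xs\<close>.
\<close>

primrec burned :: "('a, 'b) pre_digraph \<Rightarrow> 'a list \<Rightarrow> nat \<Rightarrow> 'a set" where
  "burned G xs 0 = {}"
| "burned G xs (Suc t) =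
     burned G xs t \<union> {v. \<exists>u \<in> burned G xs t. u \<rightarrow>\<^bsub>G\<^esub> v} \<union> {xs ! t}"

text \<open>
  That the process does not end before round \<open>length xs\<close> needs no separate clause: each source
  is a vertex that is still unburned when it is chosen.
\<close>

definition burning_sequence :: "('a, 'b) pre_digraph \<Rightarrow> 'a list \<Rightarrow> bool" where
  "burning_sequence G xs \<longleftrightarrow>
     (\<forall>t < length xs. xs ! t \<in> verts G - burned G xs t) \<and> burned G xs (length xs) = verts G"

definition burning_number :: "('a, 'b) pre_digraph \<Rightarrow> nat" where
  "burning_number G = (LEAST k. \<exists>xs. burning_sequence G xs \<and> length xs = k)"

text \<open>Every finite graph has a burning sequence, so the minimum is over a nonempty set.\<close>

lemma burned_append: "t \<le> length xs \<Longrightarrow> burned G (xs @ ys) t = burned G xs t"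
  by (induction t) (auto simp: nth_append)

lemma (in wf_digraph) burned_subset:
  "\<forall>t < length xs. xs ! t \<in> verts G \<Longrightarrow> t \<le> length xs \<Longrightarrow> burned G xs t \<subseteq> verts G"
  by (induction t) (auto simp: adj_in_verts)

lemma (in fin_digraph) burning_sequence_extend:
  assumes "\<forall>t < length xs. xs ! t \<in> verts G - burned G xs t"
  shows "\<exists>ys. burning_sequence G (xs @ ys)"
  using assms
proof (induction "card (verts G - burned G xs (length xs))" arbitrary: xs rule: less_induct)
  case less
  have sub: "burned G xs (length xs) \<subseteq> verts G"
    using burned_subset less.prems by blast
  show ?case
  proof (cases "burned G xs (length xs) = verts G")
    case True
    then have "burning_sequence G (xs @ [])"
      using less.prems by (simp add: burning_sequence_def)
    then show ?thesis by blast
  next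
    case False
    with sub obtain x where x: "x \<in> verts G - burned G xs (length xs)" by blast
    let ?xs = "xs @ [x]"
    have "verts G - burned G ?xs (length ?xs) \<subset> verts G - burned G xs (length xs)"
      using x by (auto simp: burned_append)
    then have "card (verts G - burned G ?xs (length ?xs)) < card (verts G - burned G xs (length xs))"
      by (intro psubset_card_mono) auto
    moreover have "\<forall>t < length ?xs. ?xs ! t \<in> verts G - burned G ?xs t"
      using less.prems x by (auto simp: nth_append burned_append less_Suc_eq)
    ultimately obtain ys where "burning_sequence G (?xs @ ys)"
      using less.hyps by blast
    then show ?thesis by (metis append_assoc)
  qed
qed

lemma (in fin_digraph) burning_sequence_exists: "\<exists>xs. burning_sequence G xs"
  using burning_sequence_extend[of "[]"] by simp

end

theory Submission
  imports Defs
begin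

text \<open>One round burns only its source, so with at least two vertices
  \<open>burning_number G = 2\<close> means that some pair \<open>[x, y]\<close> is a burning
  sequence (\<open>burning_number_eq_two_iff\<close>). After two rounds the burned set is x, its
  neighbours and y (\<open>burning_sequence_two_iff\<close>). A suitable y exists exactly when at
  most one vertex lies outside the closed neighbourhood of x, that is, when x has degree at least n
  - 2.\<close>

lemma (in nomulti_digraph) card_out_neighbours: "card {v. u \<rightarrow> v} = out_degree G u"
proof -
  have "{v. u \<rightarrow> v} = head G ` out_arcs G u"
    by (auto simp: arcs_ends_def arc_to_ends_def)
  \<comment> \<open>Out-degree counts arcs; without parallel arcs, an arc leaving \<open>u\<close>
    is determined by its head.\<close>
  moreover have "inj_on (head G) (out_arcs G u)"
    using no_multi_arcs by (auto simp: inj_on_def arc_to_ends_def)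
  ultimately show ?thesis
    by (simp add: out_degree_def card_image)
qed

text \<open>Only \<open>x\<close> is burned when \<open>y\<close> is chosen, so \<open>y\<close> may
  well be a neighbour of \<open>x\<close>; the fire at \<open>y\<close> has no round left in which
  to spread.\<close>

lemma burning_sequence_two_iff:
  "burning_sequence G [x, y] \<longleftrightarrow>
     x \<in> verts G \<and> y \<in> verts G \<and> x \<noteq> y \<and> insert x (insert y {v. x \<rightarrow>\<^bsub>G\<^esub> v}) = verts G"
  by (auto simp: burning_sequence_def less_Suc_eq numeral_2_eq_2)

lemma not_burning_sequence_short:
  assumes "card (verts G) \<ge> 2" "length xs < 2"
  shows "\<not> burning_sequence G xs"
proof (cases xs)
  case Nil
  then show ?thesis using assms by (auto simp: burning_sequence_def)
next
  case (Cons x ys)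
  with assms have "xs = [x]" by simp
  moreover have "verts G \<noteq> {x}" using assms by auto
  ultimately show ?thesis by (auto simp: burning_sequence_def)
qed

lemma (in fin_digraph) burning_number_eq_two_iff:
  assumes "card (verts G) \<ge> 2"
  shows "burning_number G = 2 \<longleftrightarrow> (\<exists>x y. burning_sequence G [x, y])"
proof
  assume "burning_number G = 2"
  \<comment> \<open>The \<open>LEAST\<close> is attained because some burning sequence
    exists.\<close>
  moreover obtain xs where "burning_sequence G xs" "length xs = burning_number G"
    using burning_sequence_exists LeastI_ex[of "\<lambda>k. \<exists>xs. burning_sequence G xs \<and> length xs = k"]
    unfolding burning_number_def by blast
  ultimately show "\<exists>x y. burning_sequence G [x, y]"
    by (auto simp: numeral_2_eq_2 length_Suc_conv)
next
  assume "\<exists>x y. burning_sequence G [x, y]"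
  then obtain x y where "burning_sequence G [x, y]" by blast
  then show "burning_number G = 2"
    unfolding burning_number_def
    using not_burning_sequence_short[OF assms]
    by (intro Least_equality) (fastforce, meson not_less)
qed

theorem theorem3p1:
  fixes G :: "('a, 'b) pre_digraph"
  assumes "graph G"
    and "card (verts G) \<ge> 2"
  shows "burning_number G = 2 \<longleftrightarrow> max_degree G \<ge> card (verts G) - 2"
proof -
  interpret graph G by fact
  let ?N = "\<lambda>x. {v. x \<rightarrow>\<^bsub>G\<^esub> v}"
  have N: "?N x \<subseteq> verts G - {x}" for x
    by (auto simp: adj_in_verts dest: adj_not_same)
  have finN: "finite (?N x)" for x
    using finite_subset[OF N[of x]] by simp
  have "verts G \<noteq> {}" using assms(2) by auto
  \<comment> \<open>This reduces the theorem to an equivalence for each fixed first source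
    \<open>x\<close>.\<close>
  then have max: "max_degree G \<ge> k \<longleftrightarrow> (\<exists>x \<in> verts G. k \<le> out_degree G x)" for k
    by (auto simp: max_degree_def Max_ge_iff)
  have "(\<exists>y. burning_sequence G [x, y]) \<longleftrightarrow> card (verts G) - 2 \<le> out_degree G x"
    if x: "x \<in> verts G" for x
  proof
    assume "\<exists>y. burning_sequence G [x, y]"
    then obtain y where "verts G = insert x (insert y (?N x))"
      unfolding burning_sequence_two_iff by metis
    \<comment> \<open>Only an inequality, since \<open>y\<close> may lie in
      \<open>?N x\<close>.\<close>
    then have "card (verts G) \<le> Suc (Suc (card (?N x)))"
      using finN[of x] by (simp add: card_insert_if)
    then show "card (verts G) - 2 \<le> out_degree G x"
      by (simp add: card_out_neighbours)
  next
    assume deg: "card (verts G) - 2 \<le> out_degree G x"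
    \<comment> \<open>The vertices that the fire from \<open>x\<close> does not reach by round 2;
      the second source has to cover them all.\<close>
    let ?R = "verts G - {x} - ?N x"
    have "card ?R = card (verts G) - 1 - out_degree G x"
      using N[of x] finN[of x] x by (simp add: card_Diff_subset card_out_neighbours)
    with deg have R: "card ?R \<le> Suc 0" by simp
    \<comment> \<open>If \<open>?R\<close> is empty, a legal second source is still required; any
      vertex \<open>z\<close> other than \<open>x\<close> serves, as it is unburned after round
      1.\<close>
    have "verts G \<noteq> {x}" using assms(2) by auto
    with x obtain z where z: "z \<in> verts G" "z \<noteq> x" by blast
    obtain y where y: "y \<in> verts G" "y \<noteq> x" "?R \<subseteq> {y}"
    proof (cases "?R = {}")
      case True
      with z that show ?thesis by blast
    next
      case False
      then obtain y where "y \<in> ?R" by blast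
      moreover from this R have "?R \<subseteq> {y}"
        by (auto simp: card_le_Suc0_iff_eq)
      ultimately show ?thesis using that by blast
    qed
    then have "burning_sequence G [x, y]"
      unfolding burning_sequence_two_iff using x N[of x] by blast
    then show "\<exists>y. burning_sequence G [x, y]" ..
  qed
  moreover have "x \<in> verts G" if "burning_sequence G [x, y]" for x y
    using that by (simp add: burning_sequence_two_iff)
  ultimately show ?thesis
    unfolding burning_number_eq_two_iff[OF assms(2)] max by blast
qed

end
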